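(* Let $d\ge1$, let $\{P_n\}$ be a monic $d$-OPS, let $\{Q_n\}$ be a co-recursive sequence of $\{P_n\}$, and let $A_1,\dots,A_d$ be the polynomials with $Q_n=P_n-\sum_{i=1}^dA_iP_{n-i}^{(i)}$ for all $n\ge0$. Let $\nabla_n^{(r)}$ be the $(d+1)\times(d+1)$ determinant whose row $j$ ($0\le j\le d$) is $$\big(Q_{n+j},\ P_{n-r+j}^{(r)},\ P_{n-r-1+j}^{(r+1)},\dots,P_{n-r-d+1+j}^{(r+d-1)}\big).$$ Then $\nabla_n^{(0)}=(-1)^{d+1}A_d\,\Delta_n^{(0)}$ for $n\ge0$, and for $r\ge1$ and $n\ge r-1$ $$\nabla_n^{(r)}=Q_{r-1}\,\Delta_{n-r+1}^{(r-1)}=\begin{cases}\big[P_{r-1}-A_1P_{r-2}^{(1)}-\dots-A_{r-1}P_0^{(r-1)}\big]\Delta_{n-r+1}^{(r-1)}&\text{if }r\le d,\\[1mm]\big[P_{r-1}-A_1P_{r-2}^{(1)}-\dots-A_dP_{r-d-1}^{(d)}\big]\Delta_{n-r+1}^{(r-1)}&\text{if }r>d.\end{cases}$$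
   Context: A monic $d$-OPS is given by complex numbers $\beta_n$ ($n\ge0$) and $\gamma_n^s$ ($n\ge1$, $0\le s\le d-1$) with $\gamma_n^0\ne0$ for all $n\ge1$. For $r\ge0$ the associated sequence of order $r$ is defined by $P_n^{(r)}=0$ for $n<0$, $P_0^{(r)}=1$ and $$P_{n+1}^{(r)}(x)=(x-\beta_{n+r})P_n^{(r)}(x)-\sum_{\nu=0}^{d-1}\gamma_{n+r-\nu}^{d-1-\nu}P_{n-1-\nu}^{(r)}(x),\quad n\ge0,$$ where terms with $n-1-\nu<0$ are zero; $P_n=P_n^{(0)}$. A co-recursive sequence $\{Q_n\}$ of $\{P_n\}$ is obtained by replacing, in the recurrence for $\{P_n\}$, $\beta_n$ by $\beta_n+\mu_n$ for $0\le n\le d-1$ and $\gamma_n^\nu$ by $\gamma_n^\nu+\eta_n^\nu$ for $1\le n\le\nu$, $1\le\nu\le d-1$ (arbitrary complex $\mu_n,\eta_n^\nu$), all other coefficients being unchanged. There are unique polynomials $A_1,\dots,A_d$, independent of $n$, with $Q_n=P_n-\sum_{i=1}^dA_iP_{n-i}^{(i)}$ for all $n\ge0$. $\Delta_n^{(r)}$ denotes the $(d+1)\times(d+1)$ determinant $\det\big(P_{n+j-i}^{(r+i)}\big)_{0\le j,i\le d}$ ($j$ row, $i$ column index). *)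

theory Defs
  imports Complex_Main "HOL-Computational_Algebra.Polynomial" "Jordan_Normal_Form.Determinant"
begin

text \<open>
  The coefficients of a monic \<open>d\<close>-OPS are functions \<open>\<beta>\<close> and \<open>\<gamma>\<close>; the coefficient
  written \<open>\<gamma>\<^sub>n\<^sup>s\<close> in the literature (lower index \<open>n \<ge> 1\<close>, upper index \<open>s < d\<close>) is \<open>\<gamma> n s\<close>.
  Values outside these ranges are never used.
\<close>

fun assoc_poly_nat ::
  "nat \<Rightarrow> (nat \<Rightarrow> complex) \<Rightarrow> (nat \<Rightarrow> nat \<Rightarrow> complex) \<Rightarrow> nat \<Rightarrow> nat \<Rightarrow> complex poly" where
  "assoc_poly_nat d \<beta> \<gamma> r 0 = 1"
| "assoc_poly_nat d \<beta> \<gamma> r (Suc n) =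
     [:- \<beta> (n + r), 1:] * assoc_poly_nat d \<beta> \<gamma> r n
     - (\<Sum>\<nu><d. if \<nu> < n
               then smult (\<gamma> (n + r - \<nu>) (d - 1 - \<nu>)) (assoc_poly_nat d \<beta> \<gamma> r (n - 1 - \<nu>))
               else 0)"

text \<open>
  \<open>assoc_poly d \<beta> \<gamma> r n\<close> is \<open>P\<^sub>n\<close> of the associated sequence of order \<open>r\<close>.  The index \<open>n\<close> is an
  integer because the determinants below contain entries of negative index.
\<close>

definition assoc_poly ::
  "nat \<Rightarrow> (nat \<Rightarrow> complex) \<Rightarrow> (nat \<Rightarrow> nat \<Rightarrow> complex) \<Rightarrow> nat \<Rightarrow> int \<Rightarrow> complex poly" where
  "assoc_poly d \<beta> \<gamma> r n = (if n < 0 then 0 else assoc_poly_nat d \<beta> \<gamma> r (nat n))"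

definition perturb_beta :: "nat \<Rightarrow> (nat \<Rightarrow> complex) \<Rightarrow> (nat \<Rightarrow> complex) \<Rightarrow> nat \<Rightarrow> complex" where
  "perturb_beta d \<beta> \<mu> n = (if n \<le> d - 1 then \<beta> n + \<mu> n else \<beta> n)"

definition perturb_gamma ::
  "nat \<Rightarrow> (nat \<Rightarrow> nat \<Rightarrow> complex) \<Rightarrow> (nat \<Rightarrow> nat \<Rightarrow> complex) \<Rightarrow> nat \<Rightarrow> nat \<Rightarrow> complex" where
  "perturb_gamma d \<gamma> \<eta> n \<nu> =
     (if 1 \<le> n \<and> n \<le> \<nu> \<and> 1 \<le> \<nu> \<and> \<nu> \<le> d - 1 then \<gamma> n \<nu> + \<eta> n \<nu> else \<gamma> n \<nu>)"

definition co_recursive ::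
  "nat \<Rightarrow> (nat \<Rightarrow> complex) \<Rightarrow> (nat \<Rightarrow> nat \<Rightarrow> complex) \<Rightarrow> (nat \<Rightarrow> complex poly) \<Rightarrow> bool" where
  "co_recursive d \<beta> \<gamma> Q \<longleftrightarrow>
     (\<exists>\<mu> \<eta>. \<forall>n. Q n = assoc_poly d (perturb_beta d \<beta> \<mu>) (perturb_gamma d \<gamma> \<eta>) 0 (int n))"

text \<open>In both matrices the first index \<open>j\<close> is the row and the second index \<open>i\<close> the column.\<close>

definition Delta_det :: "nat \<Rightarrow> (nat \<Rightarrow> int \<Rightarrow> complex poly) \<Rightarrow> nat \<Rightarrow> nat \<Rightarrow> complex poly" where
  "Delta_det d P r n = det (mat (d + 1) (d + 1) (\<lambda>(j, i). P (r + i) (int n + int j - int i)))"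

definition nabla_det ::
  "nat \<Rightarrow> (nat \<Rightarrow> int \<Rightarrow> complex poly) \<Rightarrow> (nat \<Rightarrow> complex poly) \<Rightarrow> nat \<Rightarrow> nat \<Rightarrow> complex poly" where
  "nabla_det d P Q r n =
     det (mat (d + 1) (d + 1)
       (\<lambda>(j, i). if i = 0 then Q (n + j)
                 else P (r + (i - 1)) (int n - int r - int (i - 1) + int j)))"

end

theory Submission
  imports Defs
begin

text \<open>
  Shifting indices, let \<open>Y\<^sub>s(m) = P\<^sub>m\<^sub>-\<^sub>s\<^sup>(\<^sup>s\<^sup>)\<close>, so that \<open>Y\<^sub>s(m) = 0\<close> for \<open>m < s\<close> and \<open>Y\<^sub>s(s) = 1\<close>.
  All the \<open>Y\<^sub>s\<close> obey one and the same recurrence of order \<open>d + 1\<close> past \<open>s\<close>, and so does \<open>Q\<close> from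
  index \<open>d\<close> on, because the perturbation only touches coefficients used below that.
  Matching the values at \<open>t, \<dots>, t + d\<close>, which is a unitriangular system, gives
  \<open>Q\<^sub>m = Q\<^sub>t Y\<^sub>t(m) + g\<^sub>1 Y\<^sub>t\<^sub>+\<^sub>1(m) + \<dots> + g\<^sub>d Y\<^sub>t\<^sub>+\<^sub>d(m)\<close> for all \<open>m \<ge> t\<close>.
  With \<open>t = r - 1\<close> this exhibits the first column of \<open>\<nabla>\<^sub>n\<^sup>(\<^sup>r\<^sup>)\<close> in terms of the columns of
  \<open>\<Delta>\<close>; for \<open>r = 0\<close> the same role is played by the defining relation of the \<open>A\<^sub>i\<close>.
\<close>

text \<open>Forward substitution: the sequences with smaller index are fixed first, and
  \<open>Y (t + Suc k)\<close> vanishes before \<open>t + Suc k\<close> and is 1 there, so a new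
  coefficient corrects the new value without disturbing earlier ones. Of the coefficients only
  \<open>g 0\<close> is needed explicitly later.\<close>

lemma unitriangular_interpolation:
  fixes X :: "nat \<Rightarrow> 'a::comm_ring_1" and Y :: "nat \<Rightarrow> nat \<Rightarrow> 'a"
  assumes diag: "\<And>s. Y s s = 1" and below: "\<And>s m. m < s \<Longrightarrow> Y s m = 0"
  shows "\<exists>g. g 0 = X t \<and> (\<forall>m\<in>{t..t+k}. X m = (\<Sum>i\<le>k. g i * Y (t + i) m))"
proof (induction k)
  case 0
  then show ?case by (intro exI[of _ "\<lambda>_. X t"]) (simp add: diag)
next
  case (Suc k)
  then obtain g where g0: "g 0 = X t"
    and g: "\<And>m. m \<in> {t..t+k} \<Longrightarrow> X m = (\<Sum>i\<le>k. g i * Y (t + i) m)" by blast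
  define h where "h = g(Suc k := X (t + Suc k) - (\<Sum>i\<le>k. g i * Y (t + i) (t + Suc k)))"
  have h_sum: "(\<Sum>i\<le>k. h i * Y (t + i) m) = (\<Sum>i\<le>k. g i * Y (t + i) m)" for m
    by (intro sum.cong) (auto simp: h_def)
  have "X m = (\<Sum>i\<le>Suc k. h i * Y (t + i) m)" if m: "m \<in> {t..t+Suc k}" for m
  proof (cases "m = t + Suc k")
    case True
    show ?thesis
      unfolding sum.atMost_Suc h_sum unfolding True diag by (simp add: h_def)
  next
    case False
    then show ?thesis
      using m g[of m] unfolding sum.atMost_Suc h_sum by (simp add: below)
  qed
  moreover have "h 0 = X t" by (simp add: h_def g0)
  ultimately show ?case by blast
qed

text \<open>There is no cut-off for negative indices, which keeps the operator plainly linear in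
  \<open>X\<close>. For \<open>d \<le> m\<close> none of the natural subtractions truncates, and it
  is then the true recurrence.\<close>

definition rec_step ::
  "nat \<Rightarrow> (nat \<Rightarrow> complex) \<Rightarrow> (nat \<Rightarrow> nat \<Rightarrow> complex) \<Rightarrow> (nat \<Rightarrow> complex poly) \<Rightarrow> nat \<Rightarrow> complex poly" where
  "rec_step d \<beta> \<gamma> X m =
     [:- \<beta> m, 1:] * X m - (\<Sum>\<nu><d. smult (\<gamma> (m - \<nu>) (d - 1 - \<nu>)) (X (m - 1 - \<nu>)))"

text \<open>Linearity over the polynomial ring: the coefficients \<open>g i\<close> are polynomials
  that do not depend on the index \<open>m\<close>.\<close>

lemma rec_step_sum:
  "rec_step d \<beta> \<gamma> (\<lambda>m. \<Sum>i\<in>I. g i * Y i m) m = (\<Sum>i\<in>I. g i * rec_step d \<beta> \<gamma> (Y i) m)"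
proof -
  have "(\<Sum>\<nu><d. smult (\<gamma> (m - \<nu>) (d - 1 - \<nu>)) (\<Sum>i\<in>I. g i * Y i (m - 1 - \<nu>))) =
        (\<Sum>\<nu><d. \<Sum>i\<in>I. g i * smult (\<gamma> (m - \<nu>) (d - 1 - \<nu>)) (Y i (m - 1 - \<nu>)))"
    by (intro sum.cong refl) (induction I rule: infinite_finite_induct, simp_all add: smult_add_right)
  also have "\<dots> = (\<Sum>i\<in>I. g i * (\<Sum>\<nu><d. smult (\<gamma> (m - \<nu>) (d - 1 - \<nu>)) (Y i (m - 1 - \<nu>))))"
    by (subst sum.swap) (simp only: sum_distrib_left)
  finally show ?thesis
    unfolding rec_step_def right_diff_distrib sum_subtractf
    by (simp only: sum_distrib_left mult.left_commute)
qed

lemma rec_step_cong: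
  assumes "\<And>k. k \<in> {m - d..m} \<Longrightarrow> X k = X' k"
  shows "rec_step d \<beta> \<gamma> X m = rec_step d \<beta> \<gamma> X' m"
  unfolding rec_step_def using assms
  by (intro arg_cong2[of _ _ _ _ "(-)"] arg_cong2[of _ _ _ _ "(*)"] sum.cong arg_cong2[of _ _ _ _ smult]) auto

text \<open>Counting from \<open>s\<close> makes the recurrence coefficients depend on
  \<open>m\<close> alone, so that all orders share one operator \<open>rec_step\<close>.\<close>

definition shifted_assoc ::
  "nat \<Rightarrow> (nat \<Rightarrow> complex) \<Rightarrow> (nat \<Rightarrow> nat \<Rightarrow> complex) \<Rightarrow> nat \<Rightarrow> nat \<Rightarrow> complex poly" where
  "shifted_assoc d \<beta> \<gamma> s m = assoc_poly d \<beta> \<gamma> s (int m - int s)"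

lemma shifted_assoc_diag: "shifted_assoc d \<beta> \<gamma> s s = 1"
  by (simp add: shifted_assoc_def assoc_poly_def)

lemma shifted_assoc_below: "m < s \<Longrightarrow> shifted_assoc d \<beta> \<gamma> s m = 0"
  by (simp add: shifted_assoc_def assoc_poly_def)

lemma shifted_assoc_above: "s \<le> m \<Longrightarrow> shifted_assoc d \<beta> \<gamma> s m = assoc_poly_nat d \<beta> \<gamma> s (m - s)"
  by (simp add: shifted_assoc_def assoc_poly_def nat_diff_distrib)

text \<open>The terms cut off in \<open>assoc_poly_nat\<close> have index
  \<open>m - 1 - \<nu>\<close> below \<open>s\<close>, where the shifted sequence is zero anyway.
  The bound \<open>d \<le> m\<close> ensures that this subtraction is not truncated.\<close>

lemma shifted_assoc_Suc:
  assumes "s \<le> m" "d \<le> m"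
  shows "shifted_assoc d \<beta> \<gamma> s (Suc m) = rec_step d \<beta> \<gamma> (shifted_assoc d \<beta> \<gamma> s) m"
proof -
  have "(if \<nu> < m - s then smult (\<gamma> (m - s + s - \<nu>) (d - 1 - \<nu>)) (assoc_poly_nat d \<beta> \<gamma> s (m - s - 1 - \<nu>)) else 0)
      = smult (\<gamma> (m - \<nu>) (d - 1 - \<nu>)) (shifted_assoc d \<beta> \<gamma> s (m - 1 - \<nu>))" if "\<nu> < d" for \<nu>
  proof (cases "\<nu> < m - s")
    case True
    then have "s \<le> m - 1 - \<nu>" and "m - 1 - \<nu> - s = m - s - 1 - \<nu>" by auto
    with True assms show ?thesis by (simp add: shifted_assoc_above)
  next
    case False
    with that assms have "m - 1 - \<nu> < s" by linarith
    with False show ?thesis by (simp add: shifted_assoc_below)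
  qed
  then have "(\<Sum>\<nu><d. if \<nu> < m - s then smult (\<gamma> (m - s + s - \<nu>) (d - 1 - \<nu>)) (assoc_poly_nat d \<beta> \<gamma> s (m - s - 1 - \<nu>)) else 0)
      = (\<Sum>\<nu><d. smult (\<gamma> (m - \<nu>) (d - 1 - \<nu>)) (shifted_assoc d \<beta> \<gamma> s (m - 1 - \<nu>)))"
    by (intro sum.cong) auto
  moreover have "shifted_assoc d \<beta> \<gamma> s (Suc m) = assoc_poly_nat d \<beta> \<gamma> s (Suc (m - s))"
    using assms by (simp add: shifted_assoc_above Suc_diff_le)
  ultimately show ?thesis
    using assms unfolding rec_step_def assoc_poly_nat.simps by (simp add: shifted_assoc_above)
qed

text \<open>\<open>Q\<close> is itself an order 0 sequence, for the perturbed coefficients; it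
  remains to see that these agree with the original ones at step \<open>m\<close>.\<close>

lemma co_recursive_Suc:
  assumes "co_recursive d \<beta> \<gamma> Q" "d \<ge> 1" "d \<le> m"
  shows "Q (Suc m) = rec_step d \<beta> \<gamma> Q m"
proof -
  from assms(1) obtain \<mu> \<eta> where
    "\<And>n. Q n = assoc_poly d (perturb_beta d \<beta> \<mu>) (perturb_gamma d \<gamma> \<eta>) 0 (int n)"
    unfolding co_recursive_def by blast
  then have Q: "Q = shifted_assoc d (perturb_beta d \<beta> \<mu>) (perturb_gamma d \<gamma> \<eta>) 0"
    by (auto simp: shifted_assoc_def)
  have "Q (Suc m) = rec_step d (perturb_beta d \<beta> \<mu>) (perturb_gamma d \<gamma> \<eta>) Q m"
    unfolding Q by (rule shifted_assoc_Suc) (use assms in auto)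
  also have "\<dots> = rec_step d \<beta> \<gamma> Q m"
  proof -
    have "perturb_beta d \<beta> \<mu> m = \<beta> m"
      using assms by (simp add: perturb_beta_def)
    \<comment> \<open>A perturbed entry would need \<open>m - \<nu> \<le> d - 1 - \<nu>\<close>,
      that is \<open>m \<le> d - 1\<close>.\<close>
    moreover have "perturb_gamma d \<gamma> \<eta> (m - \<nu>) (d - 1 - \<nu>) = \<gamma> (m - \<nu>) (d - 1 - \<nu>)" if "\<nu> < d" for \<nu>
      using assms that by (auto simp: perturb_gamma_def)
    ultimately show ?thesis
      unfolding rec_step_def by (intro arg_cong2[of _ _ _ _ "(-)"] sum.cong) simp_all
  qed
  finally show ?thesis .
qed

lemma expand_in_shifted_assoc:
  assumes rec: "\<And>m. t + d \<le> m \<Longrightarrow> X (Suc m) = rec_step d \<beta> \<gamma> X m"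
  shows "\<exists>g. g 0 = X t \<and> (\<forall>m\<ge>t. X m = (\<Sum>i\<le>d. g i * shifted_assoc d \<beta> \<gamma> (t + i) m))"
proof -
  let ?Y = "shifted_assoc d \<beta> \<gamma>"
  obtain g where g0: "g 0 = X t"
    and g: "\<And>m. m \<in> {t..t+d} \<Longrightarrow> X m = (\<Sum>i\<le>d. g i * ?Y (t + i) m)"
    using unitriangular_interpolation[of ?Y X t d] shifted_assoc_diag shifted_assoc_below by blast
  have "X m = (\<Sum>i\<le>d. g i * ?Y (t + i) m)" if "t \<le> m" for m
    using that
  proof (induction m rule: less_induct)
    case (less m)
    show ?case
    proof (cases "m \<le> t + d")
      case True
      with less.prems g show ?thesis by simp
    next
      case False
      then obtain k where k: "m = Suc k" "t + d \<le> k" by (cases m) auto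
      have "X m = rec_step d \<beta> \<gamma> (\<lambda>m. \<Sum>i\<le>d. g i * ?Y (t + i) m) k"
        unfolding k(1) rec[OF k(2)] by (rule rec_step_cong) (use k less.IH in auto)
      also have "\<dots> = (\<Sum>i\<le>d. g i * ?Y (t + i) m)"
        unfolding rec_step_sum k(1)
        \<comment> \<open>Every \<open>t + i\<close> is at most \<open>t + d \<le> k\<close>, so
          each basis sequence already obeys the recurrence at \<open>k\<close>.\<close>
        by (intro sum.cong refl) (use k in \<open>simp add: shifted_assoc_Suc\<close>)
      finally show ?thesis .
    qed
  qed
  with g0 show ?thesis by blast
qed

lemma det_mat_mult:
  fixes F G :: "nat \<Rightarrow> nat \<Rightarrow> 'a::comm_ring_1"
  shows "det (mat n n (\<lambda>(j, i). \<Sum>k<n. F j k * G k i)) =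
    det (mat n n (\<lambda>(j, i). F j i)) * det (mat n n (\<lambda>(j, i). G j i))"
proof -
  have "mat n n (\<lambda>(j, i). \<Sum>k<n. F j k * G k i) = mat n n (\<lambda>(j, i). F j i) * mat n n (\<lambda>(j, i). G j i)"
    by (rule eq_matI) (auto simp: scalar_prod_def atLeast0LessThan)
  then show ?thesis by (simp add: det_mult[where n = n])
qed

text \<open>Right multiplication by the identity matrix with first column replaced by
  \<open>c\<close>; this factor is lower triangular with diagonal
  \<open>c 0, 1, ..., 1\<close>.\<close>

lemma det_replace_first_col:
  fixes F :: "nat \<Rightarrow> nat \<Rightarrow> 'a::comm_ring_1"
  shows "det (mat (Suc n) (Suc n) (\<lambda>(j, i). if i = 0 then \<Sum>k\<le>n. c k * F j k else F j i)) =
    c 0 * det (mat (Suc n) (Suc n) (\<lambda>(j, i). F j i))"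
proof -
  define G where "G = (\<lambda>k i. if i = 0 then c k else if k = i then 1 else 0)"
  have "(if i = 0 then \<Sum>k\<le>n. c k * F j k else F j i) = (\<Sum>k<Suc n. F j k * G k i)"
    if "i < Suc n" for i j
    using that by (cases "i = 0") (auto simp: G_def lessThan_Suc_atMost if_distrib[of "(*) x" for x] intro!: sum.cong mult.commute cong: if_cong)
  then have "mat (Suc n) (Suc n) (\<lambda>(j, i). if i = 0 then \<Sum>k\<le>n. c k * F j k else F j i) =
      mat (Suc n) (Suc n) (\<lambda>(j, i). \<Sum>k<Suc n. F j k * G k i)"
    by (intro eq_matI) simp_all
  moreover have "det (mat (Suc n) (Suc n) (\<lambda>(j, i). G j i)) = c 0"
  proof -
    have "det (mat (Suc n) (Suc n) (\<lambda>(j, i). G j i)) = prod_list (diag_mat (mat (Suc n) (Suc n) (\<lambda>(j, i). G j i)))"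
      by (rule det_lower_triangular[of "Suc n"]) (auto simp: G_def)
    also have "\<dots> = (\<Prod>i<Suc n. G i i)"
      by (simp add: prod_list_diag_prod atLeast0LessThan del: prod.lessThan_Suc)
    also have "\<dots> = c 0"
      unfolding prod.lessThan_Suc_shift by (simp add: G_def)
    finally show ?thesis .
  qed
  ultimately show ?thesis by (simp only: det_mat_mult mult.commute)
qed

text \<open>The right factor \<open>G\<close> has first column \<open>c\<close>, followed by the
  first \<open>n\<close> unit vectors. Its last row is \<open>(c n, 0, ..., 0)\<close>, and
  expansion along it leaves an identity minor with sign \<open>(- 1) ^ n\<close>.\<close>

lemma det_prepend_col:
  fixes F :: "nat \<Rightarrow> nat \<Rightarrow> 'a::comm_ring_1"
  shows "det (mat (Suc n) (Suc n) (\<lambda>(j, i). if i = 0 then \<Sum>k\<le>n. c k * F j k else F j (i - 1))) =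
    (- 1) ^ n * c n * det (mat (Suc n) (Suc n) (\<lambda>(j, i). F j i))"
proof -
  define G where "G = (\<lambda>k i. if i = 0 then c k else if k = i - 1 then 1 else 0)"
  have "(if i = 0 then \<Sum>k\<le>n. c k * F j k else F j (i - 1)) = (\<Sum>k<Suc n. F j k * G k i)"
    if "i < Suc n" for i j
    using that by (cases "i = 0") (auto simp: G_def lessThan_Suc_atMost if_distrib[of "(*) x" for x] intro!: sum.cong mult.commute cong: if_cong)
  then have "mat (Suc n) (Suc n) (\<lambda>(j, i). if i = 0 then \<Sum>k\<le>n. c k * F j k else F j (i - 1)) =
      mat (Suc n) (Suc n) (\<lambda>(j, i). \<Sum>k<Suc n. F j k * G k i)"
    by (intro eq_matI) simp_all
  moreover have "det (mat (Suc n) (Suc n) (\<lambda>(j, i). G j i)) = (- 1) ^ n * c n"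
  proof -
    let ?M = "mat (Suc n) (Suc n) (\<lambda>(j, i). G j i)"
    have "mat_delete ?M n 0 = 1\<^sub>m n"
      by (rule eq_matI) (auto simp: mat_delete_def G_def)
    moreover have "det ?M = (\<Sum>i<Suc n. ?M $$ (n, i) * cofactor ?M n i)"
      by (rule laplace_expansion_row) auto
    ultimately show ?thesis
      by (simp add: sum.lessThan_Suc_shift G_def cofactor_def mult.commute del: sum.lessThan_Suc)
  qed
  ultimately show ?thesis by (simp only: det_mat_mult mult.commute)
qed

theorem proposition4p6:
  fixes d :: nat
    and \<beta> :: "nat \<Rightarrow> complex"
    and \<gamma> :: "nat \<Rightarrow> nat \<Rightarrow> complex"
    and P :: "nat \<Rightarrow> int \<Rightarrow> complex poly"
    and Q :: "nat \<Rightarrow> complex poly"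
    and A :: "nat \<Rightarrow> complex poly"
  assumes d: "d \<ge> 1"
    and regular: "\<forall>n\<ge>1. \<gamma> n 0 \<noteq> 0"
    and P: "P = assoc_poly d \<beta> \<gamma>"
    and Q: "co_recursive d \<beta> \<gamma> Q"
    and A: "\<forall>n. Q n = P 0 (int n) - (\<Sum>i=1..d. A i * P i (int n - int i))"
  shows "(\<forall>n. nabla_det d P Q 0 n = (- 1) ^ (d + 1) * A d * Delta_det d P 0 n) \<and>
    (\<forall>r n. r \<ge> 1 \<and> n \<ge> r - 1 \<longrightarrow>
       nabla_det d P Q r n = Q (r - 1) * Delta_det d P (r - 1) (n - (r - 1)) \<and>
       Q (r - 1) * Delta_det d P (r - 1) (n - (r - 1)) =
         (if r \<le> d
          then (P 0 (int r - 1) - (\<Sum>i=1..r - 1. A i * P i (int r - 1 - int i)))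
                 * Delta_det d P (r - 1) (n - (r - 1))
          else (P 0 (int r - 1) - (\<Sum>i=1..d. A i * P i (int r - 1 - int i)))
                 * Delta_det d P (r - 1) (n - (r - 1))))"
proof (intro conjI allI impI; (elim conjE)?)
  let ?Y = "shifted_assoc d \<beta> \<gamma>"
  \<comment> \<open>In shifted form \<Delta> is the Casorati determinant of the sequences
    \<open>?Y t, ..., ?Y (t + d)\<close> at \<open>m\<close>.\<close>
  have Delta: "Delta_det d P t (m - t) = det (mat (Suc d) (Suc d) (\<lambda>(j, i). ?Y (t + i) (m + j)))"
    if "t \<le> m" for t m
    using that unfolding Delta_det_def P shifted_assoc_def
    by (auto simp: of_nat_diff algebra_simps intro!: arg_cong[of _ _ det] eq_matI)
  show "nabla_det d P Q 0 n = (- 1) ^ (d + 1) * A d * Delta_det d P 0 n" for n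
  proof -
    define c where "c = (\<lambda>i. if i = 0 then 1 else - A i)"
    have Q_eq: "Q m = (\<Sum>i\<le>d. c i * ?Y i m)" for m
    proof -
      have "(\<Sum>i\<le>d. c i * ?Y i m) = c 0 * ?Y 0 m + (\<Sum>i=1..d. c i * ?Y i m)"
        by (simp add: atMost_atLeast0 sum.atLeast_Suc_atMost)
      also have "\<dots> = Q m"
        unfolding A[rule_format] P by (simp add: c_def shifted_assoc_def sum_negf)
      finally show ?thesis by simp
    qed
    have "nabla_det d P Q 0 n = det (mat (Suc d) (Suc d)
        (\<lambda>(j, i). if i = 0 then \<Sum>k\<le>d. c k * ?Y k (n + j) else ?Y (i - 1) (n + j)))"
      unfolding nabla_det_def P Q_eq shifted_assoc_def
      by (auto simp: algebra_simps intro!: arg_cong[of _ _ det] eq_matI)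
    also have "\<dots> = (- 1) ^ d * c d * Delta_det d P 0 n"
      using Delta[of 0 n] det_prepend_col[of d c "\<lambda>j i. ?Y i (n + j)"] by simp
    \<comment> \<open>As \<open>d \<ge> 1\<close>, \<open>c d\<close> is \<open>- A d\<close> and
      not the leading 1; this supplies the extra sign.\<close>
    finally show ?thesis using d by (simp add: c_def)
  qed
  fix r n :: nat
  assume r: "r \<ge> 1" and n: "n \<ge> r - 1"
  define t where "t = r - 1"
  have t: "r = Suc t" "t \<le> n" using r n by (auto simp: t_def)
  obtain g where g0: "g 0 = Q t" and g: "\<And>m. t \<le> m \<Longrightarrow> Q m = (\<Sum>i\<le>d. g i * ?Y (t + i) m)"
    using expand_in_shifted_assoc[of t d Q \<beta> \<gamma>] co_recursive_Suc[OF Q d] by auto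
  \<comment> \<open>With \<open>r = t + 1\<close>, column \<open>i \<ge> 1\<close> of \<nabla> is
    already column \<open>i\<close> of \<Delta> for order \<open>t\<close>; only the column of
    \<open>Q\<close> differs.\<close>
  have "nabla_det d P Q r n = det (mat (Suc d) (Suc d)
      (\<lambda>(j, i). if i = 0 then \<Sum>k\<le>d. g k * ?Y (t + k) (n + j) else ?Y (t + i) (n + j)))"
    using t g unfolding nabla_det_def P shifted_assoc_def
    by (auto simp: algebra_simps of_nat_diff intro!: arg_cong[of _ _ det] eq_matI)
  also have "\<dots> = Q t * Delta_det d P t (n - t)"
    using Delta[OF t(2)] det_replace_first_col[of d g "\<lambda>j i. ?Y (t + i) (n + j)"] g0 by simp
  finally show "nabla_det d P Q r n = Q (r - 1) * Delta_det d P (r - 1) (n - (r - 1))"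
    by (simp add: t_def)
  have Q_r: "Q (r - 1) = P 0 (int r - 1) - (\<Sum>i=1..d. A i * P i (int r - 1 - int i))"
    using A[rule_format, of "r - 1"] r by (simp add: of_nat_diff)
  \<comment> \<open>Terms with \<open>i \<ge> r\<close> carry a negative index and vanish, so both
    cases are the same sum.\<close>
  have "(\<Sum>i=1..r - 1. A i * P i (int r - 1 - int i)) = (\<Sum>i=1..d. A i * P i (int r - 1 - int i))" if "r \<le> d"
    by (rule sum.mono_neutral_left) (use that in \<open>auto simp: P assoc_poly_def\<close>)
  with Q_r show "Q (r - 1) * Delta_det d P (r - 1) (n - (r - 1)) =
      (if r \<le> d
       then (P 0 (int r - 1) - (\<Sum>i=1..r - 1. A i * P i (int r - 1 - int i)))
              * Delta_det d P (r - 1) (n - (r - 1))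
       else (P 0 (int r - 1) - (\<Sum>i=1..d. A i * P i (int r - 1 - int i)))
              * Delta_det d P (r - 1) (n - (r - 1)))"
    by simp
qed

end
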